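(* Let $\mathbb{B}$ be a complete Boolean algebra and let $\lambda$ be an infinite cardinal. If $\mathbb{B}$ is weakly $(\lambda^\omega, \omega)$-distributive, then $\mathbb{B}$ is $(\lambda, 2)$-distributive.
   Context: For ordinals $\mu,\kappa$, a complete Boolean algebra $\mathbb{B}$ is $(\mu,\kappa)$-distributive iff for every family $\langle u_{\alpha,\beta} \in \mathbb{B} : \alpha<\mu, \beta<\kappa\rangle$, $\prod_{\alpha<\mu}\sum_{\beta<\kappa} u_{\alpha,\beta} = \sum_{f:\mu\to\kappa}\prod_{\alpha<\mu} u_{\alpha,f(\alpha)}$. It is weakly $(\mu,\kappa)$-distributive iff for every such family, $\prod_{\alpha<\mu}\sum_{\beta<\kappa} u_{\alpha,\beta} = \sum_{g:\mu\to\kappa}\prod_{\alpha<\mu}\sum_{\beta<g(\alpha)} u_{\alpha,\beta}$. (Here $\prod$ and $\sum$ are infima and suprema in $\mathbb{B}$.) $\lambda^\omega$ denotes cardinal exponentiation. *)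

theory Defs
  imports Main
begin

text \<open>
  A complete Boolean algebra is a type of sort \<open>{boolean_algebra, complete_lattice}\<close>. The library
  class \<open>complete_boolean_algebra\<close> would be wrong here: its superclass
  \<open>complete_distrib_lattice\<close> demands complete distributivity, so every distributive law below
  would hold in it automatically.

  Ordinals \<open>\<mu>\<close> and \<open>\<kappa>\<close> are given by well-order relations; the \<open>\<alpha> < \<mu>\<close> are the elements of
  \<open>Field \<mu>\<close>, and \<open>underS \<kappa> \<gamma>\<close> is the set of all \<open>\<beta> < \<gamma>\<close>.
  The values of \<open>u\<close> outside \<open>Field \<mu>\<close> and \<open>Field \<kappa>\<close> are irrelevant.
\<close>

definition distributive ::
  "'a::{boolean_algebra, complete_lattice} itself \<Rightarrow> 'i rel \<Rightarrow> 'k rel \<Rightarrow> bool" where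
  "distributive _ \<mu> \<kappa> \<longleftrightarrow>
     (\<forall>u :: 'i \<Rightarrow> 'k \<Rightarrow> 'a.
        (INF \<alpha>\<in>Field \<mu>. SUP \<beta>\<in>Field \<kappa>. u \<alpha> \<beta>) =
        (SUP f\<in>Func (Field \<mu>) (Field \<kappa>). INF \<alpha>\<in>Field \<mu>. u \<alpha> (f \<alpha>)))"

definition weakly_distributive ::
  "'a::{boolean_algebra, complete_lattice} itself \<Rightarrow> 'i rel \<Rightarrow> 'k rel \<Rightarrow> bool" where
  "weakly_distributive _ \<mu> \<kappa> \<longleftrightarrow>
     (\<forall>u :: 'i \<Rightarrow> 'k \<Rightarrow> 'a.
        (INF \<alpha>\<in>Field \<mu>. SUP \<beta>\<in>Field \<kappa>. u \<alpha> \<beta>) =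
        (SUP g\<in>Func (Field \<mu>) (Field \<kappa>). INF \<alpha>\<in>Field \<mu>. SUP \<beta>\<in>underS \<kappa> (g \<alpha>). u \<alpha> \<beta>))"

end

theory Submission
  imports Defs
begin

text \<open>
  In forcing language: a family \<open>v\<close> indexed by \<open>I = Field lam\<close> names a subset \<open>A\<close> of \<open>I\<close>, where
  \<open>v \<alpha>\<close> is the truth value of \<open>\<alpha> \<in> A\<close>, and distributivity says that \<open>A\<close> lies in the ground model.
  To a ground-model sequence \<open>x : \<omega> \<rightarrow> I\<close> attach a natural number \<open>n\<close> with \<open>x n \<notin> A\<close>, or any number
  if \<open>A\<close> contains the whole range of \<open>x\<close>. Weak distributivity bounds this function of
  \<open>x \<in> I\<^sup>\<omega>\<close> by a ground-model function \<open>g\<close>: if \<open>x k \<in> A\<close> for all \<open>k < g x\<close>, then \<open>A\<close> contains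
  the range of \<open>x\<close>.

  Suppose that some condition \<open>e\<close> forces this bound and also forces \<open>A\<close> to be new. No nonzero
  condition below \<open>e\<close> decides all of \<open>A\<close> (lemma \<open>exists_splitting_index\<close>), so one can pick
  inductively \<open>x n \<in> I\<close> undecided by the current condition and then strengthen this
  condition by \<open>x n \<in> A\<close>. The sequence \<open>x\<close> lies in the ground model, and at every stage \<open>n\<close> it is
  possible that \<open>x 0, \<dots>, x (n - 1) \<in> A\<close> but \<open>x n \<notin> A\<close>. At \<open>n = g x\<close> this contradicts the bound
  (lemma \<open>bounded_escape_decides\<close>).
\<close>

text \<open>
  An element that no \<open>v \<alpha>\<close> splits decides every \<open>v \<alpha>\<close>, hence lies below the meet for the function
  that records its decisions.
\<close>
lemma exists_splitting_index:
  fixes v :: "'i \<Rightarrow> 'a::{boolean_algebra, complete_lattice}"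
  assumes nonzero: "e \<noteq> bot"
    and undecided: "\<And>f. f \<in> Func I UNIV \<Longrightarrow>
      inf e (INF \<alpha>\<in>I. if f \<alpha> then v \<alpha> else - v \<alpha>) = bot"
  shows "\<exists>\<alpha>\<in>I. inf e (v \<alpha>) \<noteq> bot \<and> inf e (- v \<alpha>) \<noteq> bot"
proof (rule ccontr)
  assume "\<not> ?thesis"
  then have decided: "inf e (v \<alpha>) = bot \<or> inf e (- v \<alpha>) = bot" if "\<alpha> \<in> I" for \<alpha>
    using that by blast
  define f where "f \<alpha> = (if \<alpha> \<in> I then inf e (- v \<alpha>) = bot else undefined)" for \<alpha>
  have "f \<in> Func I UNIV"
    by (auto simp: Func_def f_def)
  have "e \<le> (INF \<alpha>\<in>I. if f \<alpha> then v \<alpha> else - v \<alpha>)"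
  proof (rule INF_greatest)
    fix \<alpha> assume "\<alpha> \<in> I"
    then show "e \<le> (if f \<alpha> then v \<alpha> else - v \<alpha>)"
      using decided[of \<alpha>] inf_shunt[of e "v \<alpha>"] inf_shunt[of e "- v \<alpha>"] by (auto simp: f_def)
  qed
  then show False
    using undecided[OF \<open>f \<in> Func I UNIV\<close>] nonzero by (simp add: inf_absorb1)
qed

text \<open>
  The assumption says that \<open>d\<close> forces \<open>g\<close> to bound the first escape of \<open>x\<close> from the set
  named by \<open>v\<close>; the conclusion says that below \<open>d\<close> this set is in the ground model.
\<close>
lemma bounded_escape_decides:
  fixes v :: "'i \<Rightarrow> 'a::{boolean_algebra, complete_lattice}"
    and g :: "(nat \<Rightarrow> 'i) \<Rightarrow> nat"
  assumes "\<And>x. range x \<subseteq> I \<Longrightarrow> d \<le> (SUP n\<in>{..<g x}. sup (- v (x n)) (INF k. v (x k)))"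
  shows "d \<le> (SUP f\<in>Func I UNIV. INF \<alpha>\<in>I. if f \<alpha> then v \<alpha> else - v \<alpha>)" (is "d \<le> ?c")
proof (rule ccontr)
  assume "\<not> d \<le> ?c"
  define e where "e = inf d (- ?c)"
  have "e \<noteq> bot"
    using \<open>\<not> d \<le> ?c\<close> inf_shunt[of d "- ?c"] by (simp add: e_def)
  define s where "s b = (SOME \<alpha>. \<alpha> \<in> I \<and> inf b (v \<alpha>) \<noteq> bot \<and> inf b (- v \<alpha>) \<noteq> bot)" for b
  have s: "s b \<in> I \<and> inf b (v (s b)) \<noteq> bot \<and> inf b (- v (s b)) \<noteq> bot"
    if "b \<noteq> bot" "b \<le> e" for b
  proof -
    have "inf b (INF \<alpha>\<in>I. if f \<alpha> then v \<alpha> else - v \<alpha>) = bot" if "f \<in> Func I UNIV" for f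
    proof -
      have "(INF \<alpha>\<in>I. if f \<alpha> then v \<alpha> else - v \<alpha>) \<le> ?c"
        using that by (rule SUP_upper)
      moreover have "b \<le> - ?c"
        using \<open>b \<le> e\<close> by (simp add: e_def)
      ultimately have "b \<le> - (INF \<alpha>\<in>I. if f \<alpha> then v \<alpha> else - v \<alpha>)"
        using compl_mono order_trans by blast
      then show ?thesis
        by (simp add: inf_shunt)
    qed
    then have "\<exists>\<alpha>. \<alpha> \<in> I \<and> inf b (v \<alpha>) \<noteq> bot \<and> inf b (- v \<alpha>) \<noteq> bot"
      using exists_splitting_index[OF \<open>b \<noteq> bot\<close>] by blast
    then show ?thesis
      unfolding s_def by (rule someI_ex)
  qed
  define E where "E = rec_nat e (\<lambda>_ b. inf b (v (s b)))"
  define x where "x n = s (E n)" for n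
  have E_0: "E 0 = e" and E_Suc: "E (Suc n) = inf (E n) (v (x n))" for n
    by (simp_all add: E_def x_def)
  have E: "E n \<noteq> bot \<and> E n \<le> e" for n
  proof (induction n)
    case 0
    show ?case using \<open>e \<noteq> bot\<close> by (simp add: E_0)
  next
    case (Suc n)
    then show ?case using s[of "E n"] by (auto simp: E_Suc x_def intro: le_infI1)
  qed
  have E_below: "E n \<le> v (x k)" if "k < n" for k n
    using that
  proof (induction n)
    case (Suc n)
    then show ?case by (cases "k = n") (auto simp: E_Suc intro: le_infI1)
  qed simp
  have "range x \<subseteq> I"
    using s E by (auto simp: x_def)
  \<comment> \<open>\<open>h\<close> forces \<open>x\<close> to leave the set at stage \<open>g x\<close> and not before, against the bound.\<close>
  define h where "h = inf (E (g x)) (- v (x (g x)))"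
  have "h \<noteq> bot"
    using s[of "E (g x)"] E[of "g x"] by (simp add: h_def x_def)
  have "h \<le> e"
    using E[of "g x"] by (auto simp: h_def intro: le_infI1)
  then have "h \<le> d"
    by (simp add: e_def)
  also have "d \<le> (SUP n\<in>{..<g x}. sup (- v (x n)) (INF k. v (x k)))"
    using \<open>range x \<subseteq> I\<close> by (rule assms)
  also have "\<dots> \<le> - h"
  proof (rule SUP_least)
    fix n assume "n \<in> {..<g x}"
    then have "h \<le> v (x n)"
      using E_below[of n "g x"] by (auto simp: h_def intro: le_infI1)
    then have "- v (x n) \<le> - h"
      by (rule compl_mono)
    moreover have "(INF k. v (x k)) \<le> - h"
    proof -
      have "(INF k. v (x k)) \<le> v (x (g x))"
        by (rule INF_lower) simp
      also have "\<dots> \<le> - h"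
        by (simp add: h_def)
      finally show ?thesis .
    qed
    ultimately show "sup (- v (x n)) (INF k. v (x k)) \<le> - h"
      by simp
  qed
  finally have "inf h h = bot"
    using inf_shunt[of h h] by simp
  then show False
    using \<open>h \<noteq> bot\<close> by simp
qed

text \<open>
  Every sequence either stays in the set named by \<open>c\<close> forever or leaves it at some stage.
\<close>
lemma SUP_escape_eq_top:
  fixes c :: "nat \<Rightarrow> 'a::{boolean_algebra, complete_lattice}"
  shows "(SUP n. sup (- c n) (INF k. c k)) = top" (is "?s = top")
proof -
  have upper: "sup (- c n) (INF k. c k) \<le> ?s" for n
    by (rule SUP_upper) simp
  have "- ?s \<le> c n" for n
  proof -
    have "- c n \<le> ?s"
      using upper[of n] by simp
    then show ?thesis
      using compl_le_swap2 by blast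
  qed
  then have "- ?s \<le> (INF k. c k)"
    by (rule INF_greatest)
  also have "\<dots> \<le> ?s"
    using upper[of 0] by simp
  finally have "sup (- ?s) ?s = ?s"
    by (rule sup_absorb2)
  then show ?thesis
    by simp
qed

lemma weakly_distributive_decides:
  fixes lam :: "'i rel" and v :: "'i \<Rightarrow> 'a::{boolean_algebra, complete_lattice}"
  assumes "weakly_distributive TYPE('a) (BNF_Cardinal_Arithmetic.cexp lam natLeq) natLeq"
  shows "(SUP f\<in>Func (Field lam) UNIV. INF \<alpha>\<in>Field lam. if f \<alpha> then v \<alpha> else - v \<alpha>) = top"
    (is "?c = top")
proof -
  define u :: "(nat \<Rightarrow> 'i) \<Rightarrow> nat \<Rightarrow> 'a"
    where "u x n = sup (- v (x n)) (INF k. v (x k))" for x n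
  let ?X = "Field (BNF_Cardinal_Arithmetic.cexp lam natLeq)"
  have X: "?X = {x. range x \<subseteq> Field lam}"
    by (auto simp: cexp_def Field_card_of Field_natLeq Func_def)
  have underS: "underS natLeq n = {..<n}" for n
    by (auto simp: underS_def natLeq_def)
  have "(INF x\<in>?X. SUP n\<in>Field natLeq. u x n) = top"
    by (simp add: Field_natLeq u_def SUP_escape_eq_top)
  then have "top = (SUP g\<in>Func ?X (Field natLeq). INF x\<in>?X. SUP n\<in>underS natLeq (g x). u x n)"
    using assms[unfolded weakly_distributive_def, THEN spec[where x = u]] by metis
  also have "\<dots> \<le> ?c"
  proof (rule SUP_least)
    fix g
    show "(INF x\<in>?X. SUP n\<in>underS natLeq (g x). u x n) \<le> ?c"
    proof (rule bounded_escape_decides)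
      fix x :: "nat \<Rightarrow> 'i" assume "range x \<subseteq> Field lam"
      then have "x \<in> ?X"
        by (simp add: X)
      then show "(INF x\<in>?X. SUP n\<in>underS natLeq (g x). u x n)
          \<le> (SUP n\<in>{..<g x}. sup (- v (x n)) (INF k. v (x k)))"
        by (rule INF_lower2) (simp add: underS u_def)
    qed
  qed
  finally show ?thesis
    by (simp add: top_unique)
qed

text \<open>
  Complementary pairs suffice: let \<open>v \<alpha>\<close> be the entry with second index \<open>True\<close>. Below the left-hand
  side of the law, \<open>- v \<alpha>\<close> lies under the other entry.
\<close>
theorem mainTheorem1:
  fixes lam :: "'i rel"
  assumes "Cinfinite lam"
    and "weakly_distributive TYPE('a::{boolean_algebra, complete_lattice})
      (BNF_Cardinal_Arithmetic.cexp lam natLeq) natLeq"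
  shows "distributive TYPE('a) lam BNF_Cardinal_Arithmetic.ctwo"
  unfolding distributive_def
proof (intro allI antisym)
  fix u :: "'i \<Rightarrow> bool \<Rightarrow> 'a"
  let ?I = "Field lam" and ?T = "Field BNF_Cardinal_Arithmetic.ctwo"
  let ?b = "INF \<alpha>\<in>?I. SUP \<beta>\<in>?T. u \<alpha> \<beta>"
  let ?c = "SUP f\<in>Func ?I ?T. INF \<alpha>\<in>?I. u \<alpha> (f \<alpha>)"
  have T: "?T = UNIV"
    by (simp add: ctwo_def Field_card_of)
  show "?b \<le> ?c"
  proof -
    have "top = (SUP f\<in>Func ?I UNIV. INF \<alpha>\<in>?I. if f \<alpha> then u \<alpha> True else - u \<alpha> True)"
      using weakly_distributive_decides[OF assms(2)] by (rule sym)
    also have "\<dots> \<le> sup (- ?b) ?c"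
    proof (rule SUP_least)
      fix f :: "'i \<Rightarrow> bool" assume f: "f \<in> Func ?I UNIV"
      let ?m = "INF \<alpha>\<in>?I. if f \<alpha> then u \<alpha> True else - u \<alpha> True"
      have "inf ?b ?m \<le> (INF \<alpha>\<in>?I. u \<alpha> (f \<alpha>))"
      proof (rule INF_greatest)
        fix \<alpha> assume \<alpha>: "\<alpha> \<in> ?I"
        have "?b \<le> sup (u \<alpha> True) (u \<alpha> False)"
          using \<alpha> by (rule INF_lower2) (simp add: T UNIV_bool sup_commute)
        moreover have "?m \<le> (if f \<alpha> then u \<alpha> True else - u \<alpha> True)"
          using \<alpha> by (rule INF_lower)
        ultimately have "inf ?b ?m
            \<le> inf (sup (u \<alpha> True) (u \<alpha> False)) (if f \<alpha> then u \<alpha> True else - u \<alpha> True)"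
          by (rule inf_mono)
        also have "\<dots> \<le> u \<alpha> (f \<alpha>)"
          by (cases "f \<alpha>") (simp_all add: inf_sup_distrib2)
        finally show "inf ?b ?m \<le> u \<alpha> (f \<alpha>)" .
      qed
      also have "\<dots> \<le> ?c"
        using f by (intro SUP_upper) (simp add: T)
      finally show "?m \<le> sup (- ?b) ?c"
        using shunt1[of ?m ?b ?c] inf_commute[of ?b ?m] by metis
    qed
    finally have "top \<le> sup (- ?b) ?c" .
    then show ?thesis
      using shunt1[of top ?b ?c] by simp
  qed
  show "?c \<le> ?b"
  proof (intro SUP_least INF_greatest)
    fix f \<alpha> assume f: "f \<in> Func ?I ?T" and \<alpha>: "\<alpha> \<in> ?I"
    have "(INF \<alpha>\<in>?I. u \<alpha> (f \<alpha>)) \<le> u \<alpha> (f \<alpha>)"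
      using \<alpha> by (rule INF_lower)
    also have "\<dots> \<le> (SUP \<beta>\<in>?T. u \<alpha> \<beta>)"
      by (rule SUP_upper) (simp add: T)
    finally show "(INF \<alpha>\<in>?I. u \<alpha> (f \<alpha>)) \<le> (SUP \<beta>\<in>?T. u \<alpha> \<beta>)" .
  qed
qed

end
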